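(* For all integers $\ell\ge 2$ and $m\ge \ell+1$, $$\frac{d_\ell^2(m)}{d_\ell(m-1)\,d_\ell(m+1)}>\frac{m^2+1}{m^2}.$$
   Context: For integers $0\le \ell\le m$, the Boros-Moll numbers are $$d_\ell(m)=2^{-2m}\sum_{k=\ell}^m 2^k \binom{2m-2k}{m-k}\binom{m+k}{k}\binom{k}{\ell},$$ and $d_\ell^2(m)$ denotes $(d_\ell(m))^2$. *)

theory Defs
  imports Complex_Main
begin

(* The natural-number subtractions are exact, since k <= m throughout the sum.
   The intended domain is l <= m; for l > m the sum is empty and the value is 0. *)
definition boros_moll :: "nat \<Rightarrow> nat \<Rightarrow> real" where
  "boros_moll l m =
     (\<Sum>k = l..m. 2 ^ k * real ((2 * m - 2 * k) choose (m - k))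
                   * real ((m + k) choose k) * real (k choose l)) / 2 ^ (2 * m)"

end

theory Submission
  imports Defs
begin

text \<open>
  Zeilberger's algorithm gives a three-term recurrence \<open>d(m+1) = A d(m) - B d(m-1)\<close> for fixed \<open>l\<close>.
  As \<open>x \<mapsto> A - B / x\<close> is increasing, the recurrence propagates by induction the lower bound
  \<open>(4 m\<^sup>2 + 7 m + l + 3) / (2 (m + 1 - l) (m + 1))\<close> for \<open>d(m+1) / d(m)\<close>, which is an equality at
  \<open>m = l\<close>. Eliminating \<open>d(m+1)\<close> from the claim leaves a quadratic inequality in
  \<open>r = d(m) / d(m-1)\<close>; the quadratic polynomial is positive and nondecreasing from the lower bound on.
\<close>

section \<open>The summand and its ratios in \<open>m\<close> and in \<open>k\<close>\<close>

text \<open>The cutoff is needed because for \<open>k > m\<close> truncated subtraction turns the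
  first binomial coefficient into \<open>0 choose 0 = 1\<close>, which would leave spurious terms.
  With it, the sums for neighbouring \<open>m\<close> can share one index range.\<close>

definition bm_term :: "nat \<Rightarrow> nat \<Rightarrow> nat \<Rightarrow> real" where
  "bm_term l m k = (if k \<le> m then 2 ^ k * real ((2 * m - 2 * k) choose (m - k))
     * real ((m + k) choose k) * real (k choose l) / 2 ^ (2 * m) else 0)"

lemma bm_term_eq_0: "m < k \<Longrightarrow> bm_term l m k = 0"
  by (simp add: bm_term_def)

lemma boros_moll_eq_sum:
  assumes "m \<le> N"
  shows "boros_moll l m = (\<Sum>k<Suc N. bm_term l m k)"
proof -
  have "boros_moll l m = (\<Sum>k=l..m. bm_term l m k)"
    unfolding boros_moll_def sum_divide_distrib
    by (intro sum.cong refl) (simp add: bm_term_def)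
  also have "\<dots> = (\<Sum>k<Suc N. bm_term l m k)"
    using assms by (intro sum.mono_neutral_left) (auto simp: bm_term_def)
  finally show ?thesis .
qed

lemma boros_moll_pos:
  assumes "l \<le> m"
  shows "boros_moll l m > 0"
  unfolding boros_moll_def using assms
  by (intro divide_pos_pos sum_pos) auto

lemma central_binomial_Suc:
  "real (Suc n) * real ((2 * Suc n) choose Suc n) = 2 * (2 * real n + 1) * real ((2 * n) choose n)"
proof -
  have "Suc n * (Suc (Suc (2 * n)) choose Suc n) = Suc (Suc (2 * n)) * (Suc (2 * n) choose n)"
    by (rule Suc_times_binomial)
  moreover have "Suc n * (Suc (2 * n) choose n) = Suc (2 * n) * (2 * n choose n)"
    using Suc_times_binomial[of n "2 * n"] binomial_symmetric[of n "Suc (2 * n)"]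
    by (simp add: Suc_diff_le)
  ultimately have "Suc n * (Suc n * (Suc (Suc (2 * n)) choose Suc n))
      = Suc n * (2 * (Suc (2 * n) * (2 * n choose n)))"
    by (metis (no_types, lifting) mult.assoc mult.left_commute mult_2 mult_Suc_right add_Suc_right add_Suc)
  then have "Suc n * (Suc (Suc (2 * n)) choose Suc n) = 2 * (Suc (2 * n) * (2 * n choose n))"
    by (simp only: mult_cancel1) simp
  then have "real (Suc n * (Suc (Suc (2 * n)) choose Suc n)) = real (2 * (Suc (2 * n) * (2 * n choose n)))"
    by (rule arg_cong)
  then show ?thesis
    by (simp add: algebra_simps del: binomial_Suc_Suc)
qed

text \<open>The ratio splits into those of the central binomial coefficient at \<open>m - k\<close>
  and of \<open>(m + k) choose k\<close>, together with 1/4 from the power of 2. With denominators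
  cleared it survives at \<open>k = m + 1\<close>, where the left factor vanishes.\<close>

lemma bm_term_Suc_left:
  "2 * (real m - real k + 1) * (real m + 1) * bm_term l (Suc m) k
     = (2 * (real m - real k) + 1) * (real m + real k + 1) * bm_term l m k"
proof (cases "k \<le> m")
  case True
  then obtain n where m: "m = k + n"
    using le_Suc_ex by blast
  define c where "c = real ((2 * n) choose n)"
  define c' where "c' = real ((2 * Suc n) choose Suc n)"
  define e where "e = real ((m + k) choose k)"
  define e' where "e' = real ((Suc m + k) choose k)"
  have c: "(real n + 1) * c' = 2 * (2 * real n + 1) * c"
    using central_binomial_Suc[of n] by (simp add: c_def c'_def add.commute)
  have "Suc m * (Suc (m + k) choose k) = Suc (m + k) * ((m + k) choose k)"
    using Suc_times_binomial[of m "m + k"] binomial_symmetric[of k "m + k"]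
      binomial_symmetric[of k "Suc (m + k)"] by (simp add: Suc_diff_le)
  then have "real (Suc m * (Suc (m + k) choose k)) = real (Suc (m + k) * ((m + k) choose k))"
    by simp
  then have e: "(real m + 1) * e' = (real m + real k + 1) * e"
    by (simp add: e_def e'_def algebra_simps)
  have t: "bm_term l m k = 2 ^ k * c * e * real (k choose l) / 2 ^ (2 * m)"
    by (simp add: bm_term_def m c_def e_def)
  have t': "bm_term l (Suc m) k = 2 ^ k * c' * e' * real (k choose l) / (4 * 2 ^ (2 * m))"
    by (simp add: bm_term_def m c'_def e'_def diff_mult_distrib2[symmetric] Suc_diff_le del: binomial_Suc_Suc)
  have "2 * (real m - real k + 1) * (real m + 1) * bm_term l (Suc m) k
      = ((real n + 1) * c') * ((real m + 1) * e') * (2 ^ k * real (k choose l) / (2 * 2 ^ (2 * m)))"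
    unfolding t' by (simp add: m field_simps)
  also have "\<dots> = (2 * (real m - real k) + 1) * (real m + real k + 1) * bm_term l m k"
    unfolding c e t by (simp add: m field_simps)
  finally show ?thesis .
next
  case False
  then show ?thesis
    by (cases "k = Suc m") (auto simp: bm_term_def)
qed

text \<open>Clearing denominators keeps the cases \<open>k + 1 = l\<close>, where the left factor
  cancels a nonzero term, and \<open>k = m\<close>, where both sides are zero.\<close>

lemma bm_term_Suc_right:
  assumes "k \<le> m"
  shows "(real k + 1 - real l) * (2 * (real m - real k) - 1) * bm_term l m (Suc k)
           = (real m - real k) * (real m + real k + 1) * bm_term l m k"
proof (cases "k = m")
  case True
  then show ?thesis
    by (simp add: bm_term_def)
next
  case False
  then obtain n where m: "m = Suc (k + n)"
    using assms less_imp_Suc_add le_neq_implies_less by blast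
  define c where "c = real ((2 * n) choose n)"
  define c' where "c' = real ((2 * Suc n) choose Suc n)"
  define e where "e = real ((m + k) choose k)"
  define e' where "e' = real ((m + Suc k) choose Suc k)"
  define f where "f = real (k choose l)"
  define f' where "f' = real (Suc k choose l)"
  have c: "(real n + 1) * c' = 2 * (2 * real n + 1) * c"
    using central_binomial_Suc[of n] by (simp add: c_def c'_def add.commute)
  have "real (Suc k * (Suc (m + k) choose Suc k)) = real (Suc (m + k) * ((m + k) choose k))"
    by (simp only: Suc_times_binomial)
  then have e: "(real k + 1) * e' = (real m + real k + 1) * e"
    by (simp add: e_def e'_def algebra_simps)
  have f: "(real k + 1 - real l) * f' = (real k + 1) * f"
  proof (cases "l \<le> Suc k")
    case True
    have "(Suc k - l) * (Suc k choose l) = Suc k * (k choose l)"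
      using binomial_absorb_comp[of "Suc k" l] by simp
    then have "real (Suc k - l) * f' = real (Suc k) * f"
      unfolding f_def f'_def by (simp only: of_nat_mult[symmetric])
    then show ?thesis
      using True by (simp add: of_nat_diff algebra_simps)
  qed (simp add: f_def f'_def binomial_eq_0 del: binomial_Suc_Suc)
  have t: "bm_term l m k = 2 ^ k * c' * e * f / 2 ^ (2 * m)"
    by (simp add: bm_term_def m c'_def e_def f_def diff_mult_distrib2[symmetric] Suc_diff_le
        del: binomial_Suc_Suc)
  have t': "bm_term l m (Suc k) = 2 ^ Suc k * c * e' * f' / 2 ^ (2 * m)"
    by (simp add: bm_term_def m c_def e'_def f'_def del: binomial_Suc_Suc)
  have "(real k + 1 - real l) * (2 * (real m - real k) - 1) * bm_term l m (Suc k)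
      = ((real k + 1 - real l) * f') * e' * (2 * (2 * real n + 1) * c) * (2 ^ k / 2 ^ (2 * m))"
    unfolding t' by (simp add: m field_simps)
  also have "\<dots> = ((real k + 1) * e') * f * ((real n + 1) * c') * (2 ^ k / 2 ^ (2 * m))"
    unfolding c f by simp
  also have "\<dots> = (real m - real k) * (real m + real k + 1) * bm_term l m k"
    unfolding e t by (simp add: m)
  finally show ?thesis .
qed

section \<open>Creative telescoping and the recurrence in \<open>m\<close>\<close>

text \<open>The Wilf--Zeilberger certificate of the recurrence.\<close>

definition bm_cert_poly :: "real \<Rightarrow> real \<Rightarrow> real \<Rightarrow> real" where
  "bm_cert_poly l m k = 4 * (m + 1 - l) * (k - m - 1) * (k + m) + (2 * m + 2) * (2 * m + 1)
     + (2 - 8 * m\<^sup>2) * (k - m - 1)"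

text \<open>A multiple of the summand at \<open>Suc m\<close> rather than at \<open>m\<close>: the
  latter is zero at \<open>k = m + 1\<close>, where the certificate still has to account for the top
  term of the sum for \<open>m + 1\<close>.\<close>

definition bm_cert :: "nat \<Rightarrow> nat \<Rightarrow> nat \<Rightarrow> real" where
  "bm_cert l m k = 4 * real m * (real m + 1) * (real k - real l) * bm_cert_poly l m k
     / ((real m + real k) * (2 * (real m - real k) + 1) * (real m + 1 + real k))
     * bm_term l (Suc m) k"

text \<open>This is what remains of the telescoping identity, with \<open>n = m - k\<close>, once
  every term is a rational multiple of \<open>bm_term l m k\<close> and the common denominator
  \<open>(2 * n - 1) * (m + k) * (n + 1)\<close> is cleared.\<close>

lemma cert_identity:
  fixes l m k n :: real
  assumes "m = k + n"
  shows "bm_cert_poly l m (k + 1) * (n + 1) * (m + k) - (k - l) * (2 * n - 1) * bm_cert_poly l m k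
    = (m + 1 - l) * (2 * n + 1) * (m + 1 + k) * (2 * n - 1) * (m + k)
      - (8 * m\<^sup>2 + 8 * m + 3 - 4 * l\<^sup>2) * (n + 1) * (m + k) * (2 * n - 1)
      + (m + l) * (16 * m\<^sup>2 - 1) * n * (n + 1)"
  unfolding bm_cert_poly_def assms by (simp add: algebra_simps power2_eq_square)

lemma bm_cert_telescope:
  assumes "m \<ge> 1" "k \<le> Suc m"
  shows "4 * (real m + 1 - real l) * real m * (real m + 1) * bm_term l (Suc m) k
     - 2 * real m * (8 * (real m)\<^sup>2 + 8 * real m + 3 - 4 * (real l)\<^sup>2) * bm_term l m k
     + (real m + real l) * (16 * (real m)\<^sup>2 - 1) * bm_term l (m - 1) k
     = bm_cert l m (Suc k) - bm_cert l m k"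
proof (cases "k = Suc m")
  case True
  \<comment> \<open>At \<open>k = m + 1\<close> only the summand at \<open>Suc m\<close> is nonzero,
    so nothing can be expressed through \<open>bm_term l m k\<close>; this boundary value is
    computed directly.\<close>
  have p: "bm_cert_poly l m (Suc m) = (2 * real m + 2) * (2 * real m + 1)"
    by (simp add: bm_cert_poly_def)
  have d: "(real m + real (Suc m)) * (2 * (real m - real (Suc m)) + 1) * (real m + 1 + real (Suc m))
      = - ((2 * real m + 2) * (2 * real m + 1))"
    by (simp add: algebra_simps)
  have "(2 * real m + 2) * (2 * real m + 1) \<noteq> 0"
    by (simp add: add_pos_pos[THEN less_imp_neq, symmetric] add_nonneg_pos[THEN less_imp_neq, symmetric])
  then have "bm_cert l m (Suc m)
      = - (4 * (real m + 1 - real l) * real m * (real m + 1) * bm_term l (Suc m) (Suc m))"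
    unfolding bm_cert_def p d by (simp add: field_simps)
  then show ?thesis
    using True by (simp add: bm_cert_def[of l m "Suc (Suc m)"] bm_term_eq_0)
next
  case False
  with assms have "k \<le> m" by simp
  define n where "n = real m - real k"
  define M K L X Y where "M = real m" and "K = real k" and "L = real l"
    and "X = bm_term l m k" and "Y = bm_term l (Suc m) k"
  have MKn: "M = K + n" by (simp add: M_def K_def n_def)
  have n0: "n \<ge> 0" using \<open>k \<le> m\<close> by (simp add: n_def)
  have M1: "M \<ge> 1" and K0: "K \<ge> 0" using assms by (simp_all add: M_def K_def)
  \<comment> \<open>Integrality of \<open>n\<close> enters here: \<open>2 * n - 1\<close> is either
    -1 or at least 1.\<close>
  have "k = m \<or> real k + 1 \<le> real m"
    using \<open>k \<le> m\<close> by linarith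
  then have odd: "2 * n - 1 \<noteq> 0"
    by (auto simp: n_def)
  have nz: "n + 1 \<noteq> 0" "2 * n + 1 \<noteq> 0" "M + K \<noteq> 0" "M + 1 \<noteq> 0" "M + K + 1 \<noteq> 0" "M + K + 2 \<noteq> 0"
    using n0 M1 K0 by linarith+
  have "2 * (n + 1) * (M + 1) * Y = (2 * n + 1) * (M + K + 1) * X"
    using bm_term_Suc_left[of m k l] by (simp only: Y_def X_def M_def K_def n_def)
  then have Y: "Y = (2 * n + 1) * (M + K + 1) / (2 * (n + 1) * (M + 1)) * X"
    using nz by (simp add: divide_simps mult_ac)
  have Z: "bm_term l (m - 1) k = 2 * n * M / ((2 * n - 1) * (M + K)) * X"
  proof -
    obtain m' where m': "m = Suc m'" using assms by (cases m) auto
    have "2 * n * M * X = (2 * n - 1) * (M + K) * bm_term l (m - 1) k"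
      using bm_term_Suc_left[of m' k l] unfolding X_def M_def K_def n_def m'
      by (simp add: algebra_simps)
    then show ?thesis using nz odd by (simp add: divide_simps mult_ac)
  qed
  have "(K + 1 - L) * (2 * n + 1) * bm_term l (Suc m) (Suc k) = (n + 1) * (M + K + 2) * Y"
    using bm_term_Suc_right[of k "Suc m" l] \<open>k \<le> m\<close> unfolding Y_def M_def K_def L_def n_def
    by (simp add: algebra_simps)
  \<comment> \<open>The factor \<open>K + 1 - L\<close> stays on the left because it vanishes at
    \<open>k + 1 = l\<close>; the certificate at \<open>Suc k\<close> contains the same
    factor.\<close>
  then have V: "(K + 1 - L) * bm_term l (Suc m) (Suc k) = (n + 1) * (M + K + 2) / (2 * n + 1) * Y"
    using nz by (simp add: divide_simps mult_ac)
  have G1: "bm_cert l m (Suc k) = 2 * M * bm_cert_poly L M (K + 1) / (2 * n - 1) * X"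
  proof -
    have "bm_cert l m (Suc k) = 4 * M * (M + 1) * bm_cert_poly L M (K + 1)
        / ((M + K + 1) * (2 * n - 1) * (M + K + 2)) * ((K + 1 - L) * bm_term l (Suc m) (Suc k))"
      unfolding bm_cert_def M_def K_def L_def n_def by (simp add: algebra_simps)
    also have "\<dots> = 2 * M * bm_cert_poly L M (K + 1) / (2 * n - 1) * X"
      unfolding V Y using nz odd by (simp add: divide_simps)
    finally show ?thesis .
  qed
  have G0: "bm_cert l m k = 2 * M * (K - L) * bm_cert_poly L M K / ((M + K) * (n + 1)) * X"
  proof -
    have "bm_cert l m k = 4 * M * (M + 1) * (K - L) * bm_cert_poly L M K
        / ((M + K) * (2 * n + 1) * (M + K + 1)) * Y"
      unfolding bm_cert_def M_def K_def L_def n_def Y_def by (simp add: add_ac)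
    also have "\<dots> = 2 * M * (K - L) * bm_cert_poly L M K / ((M + K) * (n + 1)) * X"
      unfolding Y using nz by (simp add: divide_simps)
    finally show ?thesis .
  qed
  let ?D = "(2 * n - 1) * (M + K) * (n + 1)"
  have "4 * (M + 1 - L) * M * (M + 1) * Y
     - 2 * M * (8 * M\<^sup>2 + 8 * M + 3 - 4 * L\<^sup>2) * X
     + (M + L) * (16 * M\<^sup>2 - 1) * (2 * n * M / ((2 * n - 1) * (M + K)) * X)
    = 2 * M * X * ((M + 1 - L) * (2 * n + 1) * (M + 1 + K) * (2 * n - 1) * (M + K)
      - (8 * M\<^sup>2 + 8 * M + 3 - 4 * L\<^sup>2) * (n + 1) * (M + K) * (2 * n - 1)
      + (M + L) * (16 * M\<^sup>2 - 1) * n * (n + 1)) / ?D"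
  proof -
    have "4 * (M + 1 - L) * M * (M + 1) * Y
      = 2 * M * X * ((M + 1 - L) * (2 * n + 1) * (M + 1 + K) * (2 * n - 1) * (M + K)) / ?D"
      unfolding Y using nz odd by (simp add: divide_simps) (simp add: algebra_simps)
    moreover have "2 * M * (8 * M\<^sup>2 + 8 * M + 3 - 4 * L\<^sup>2) * X
      = 2 * M * X * ((8 * M\<^sup>2 + 8 * M + 3 - 4 * L\<^sup>2) * (n + 1) * (M + K) * (2 * n - 1)) / ?D"
      using nz odd by (simp add: divide_simps)
    moreover have "(M + L) * (16 * M\<^sup>2 - 1) * (2 * n * M / ((2 * n - 1) * (M + K)) * X)
      = 2 * M * X * ((M + L) * (16 * M\<^sup>2 - 1) * n * (n + 1)) / ?D"
      using nz odd by (simp add: divide_simps)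
    ultimately show ?thesis
      by (simp only: add_divide_distrib diff_divide_distrib right_diff_distrib distrib_left)
  qed
  also have "\<dots> = 2 * M * X * (bm_cert_poly L M (K + 1) * (n + 1) * (M + K)
      - (K - L) * (2 * n - 1) * bm_cert_poly L M K) / ?D"
    by (simp only: cert_identity[OF MKn])
  also have "\<dots> = bm_cert l m (Suc k) - bm_cert l m k"
    unfolding G1 G0 using nz odd by (simp add: divide_simps) (simp add: algebra_simps)
  finally show ?thesis
    unfolding Z unfolding M_def K_def L_def X_def Y_def .
qed

lemma boros_moll_recurrence:
  assumes "m \<ge> 1"
  shows "4 * (real m + 1 - real l) * real m * (real m + 1) * boros_moll l (Suc m)
     = 2 * real m * (8 * (real m)\<^sup>2 + 8 * real m + 3 - 4 * (real l)\<^sup>2) * boros_moll l m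
     - (real m + real l) * (16 * (real m)\<^sup>2 - 1) * boros_moll l (m - 1)"
proof -
  let ?S = "\<lambda>m'. \<Sum>k<Suc (Suc m). bm_term l m' k"
  let ?E = "4 * (real m + 1 - real l) * real m * (real m + 1)"
  let ?a = "2 * real m * (8 * (real m)\<^sup>2 + 8 * real m + 3 - 4 * (real l)\<^sup>2)"
  let ?b = "(real m + real l) * (16 * (real m)\<^sup>2 - 1)"
  have "?E * ?S (Suc m) - ?a * ?S m + ?b * ?S (m - 1)
      = (\<Sum>k<Suc (Suc m). ?E * bm_term l (Suc m) k - ?a * bm_term l m k + ?b * bm_term l (m - 1) k)"
    by (simp only: sum_distrib_left sum.distrib sum_subtractf)
  also have "\<dots> = (\<Sum>k<Suc (Suc m). bm_cert l m (Suc k) - bm_cert l m k)"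
    using assms by (intro sum.cong refl bm_cert_telescope) auto
  also have "\<dots> = bm_cert l m (Suc (Suc m)) - bm_cert l m 0"
    by (rule sum_lessThan_telescope)
  \<comment> \<open>At \<open>m + 2\<close> the summand is beyond its cutoff. At 0 either
    \<open>l = 0\<close> and the factor \<open>k - l\<close> vanishes, or \<open>l > 0\<close> and
    \<open>0 choose l = 0\<close>.\<close>
  also have "\<dots> = 0"
    by (cases l) (simp_all add: bm_cert_def bm_term_def)
  finally show ?thesis
    using boros_moll_eq_sum[of "Suc m" "Suc m" l] boros_moll_eq_sum[of m "Suc m" l]
      boros_moll_eq_sum[of "m - 1" "Suc m" l] by simp
qed

section \<open>Lower bound for the ratio of consecutive values\<close>

lemma boros_moll_ratio_lower_bound:
  assumes "l \<ge> 1" "l \<le> m"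
  shows "(4 * (real m)\<^sup>2 + 7 * real m + real l + 3) * boros_moll l m
           \<le> 2 * (real m + 1 - real l) * (real m + 1) * boros_moll l (Suc m)"
  using assms(2)
proof (induction m rule: dec_induct)
  case base
  \<comment> \<open>The last term of the recurrence drops out at \<open>m = l\<close>, which
    determines the first ratio exactly.\<close>
  have "boros_moll l (l - 1) = 0"
    using assms(1) by (simp add: boros_moll_def)
  then have "2 * real l * (2 * (real l + 1) * boros_moll l (Suc l))
      = 2 * real l * ((4 * (real l)\<^sup>2 + 8 * real l + 3) * boros_moll l l)"
    using boros_moll_recurrence[OF assms(1), of l] by (simp add: algebra_simps)
  then have "2 * (real l + 1) * boros_moll l (Suc l) = (4 * (real l)\<^sup>2 + 8 * real l + 3) * boros_moll l l"
    using assms(1) by (subst (asm) mult_cancel_left) simp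
  then show ?case
    by (simp add: algebra_simps)
next
  case (step j)
  define M L where "M = real (Suc j)" and "L = real l"
  define D0 D1 D2 where "D0 = boros_moll l j" and "D1 = boros_moll l (Suc j)"
    and "D2 = boros_moll l (Suc (Suc j))"
  \<comment> \<open>This is \<open>4 * j\<^sup>2 + 7 * j + l + 3\<close> rewritten with
    \<open>j = M - 1\<close>, the coefficient in the induction hypothesis.\<close>
  define N where "N = 4 * M\<^sup>2 - M + L"
  have bounds: "M \<ge> L + 1" "L \<ge> 1"
    using step assms(1) by (simp_all add: M_def L_def)
  have pos: "D1 > 0" using boros_moll_pos[of l "Suc j"] step by (simp add: D1_def)
  have IH: "N * D0 \<le> 2 * (M - L) * M * D1"
    using step.IH by (simp add: N_def M_def L_def D0_def D1_def algebra_simps power2_eq_square)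
  have rec: "4 * (M + 1 - L) * M * (M + 1) * D2
      = 2 * M * (8 * M\<^sup>2 + 8 * M + 3 - 4 * L\<^sup>2) * D1 - (M + L) * (16 * M\<^sup>2 - 1) * D0"
    using boros_moll_recurrence[of "Suc j" l] by (simp add: M_def L_def D0_def D1_def D2_def)
  have "M\<^sup>2 \<ge> M" using bounds by (simp add: power2_eq_square)
  then have N: "N > 0" using bounds by (simp add: N_def)
  have b: "(M + L) * (16 * M\<^sup>2 - 1) \<ge> 0"
    using \<open>M\<^sup>2 \<ge> M\<close> bounds by (intro mult_nonneg_nonneg) auto
  \<comment> \<open>Scaling the recurrence by \<open>N\<close> makes \<open>D0\<close> occur as
    \<open>N * D0\<close>, which the induction hypothesis bounds; its coefficient in the recurrence
    is nonpositive.\<close>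
  have "2 * M * N * (2 * (M + 1 - L) * (M + 1) * D2)
      = N * (2 * M * (8 * M\<^sup>2 + 8 * M + 3 - 4 * L\<^sup>2) * D1) - (M + L) * (16 * M\<^sup>2 - 1) * (N * D0)"
    using arg_cong[OF rec, of "\<lambda>x. N * x"] by (simp only: right_diff_distrib mult_ac)
  also have "\<dots> \<ge> N * (2 * M * (8 * M\<^sup>2 + 8 * M + 3 - 4 * L\<^sup>2) * D1)
      - (M + L) * (16 * M\<^sup>2 - 1) * (2 * (M - L) * M * D1)"
    using mult_left_mono[OF IH b] by simp
  finally have 1: "N * (2 * M * (8 * M\<^sup>2 + 8 * M + 3 - 4 * L\<^sup>2) * D1)
      - (M + L) * (16 * M\<^sup>2 - 1) * (2 * (M - L) * M * D1)
      \<le> 2 * M * N * (2 * (M + 1 - L) * (M + 1) * D2)" .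
  \<comment> \<open>The bound propagates because the value obtained exceeds the required one by an
    explicit nonnegative surplus, the last summand.\<close>
  have "N * (2 * M * (8 * M\<^sup>2 + 8 * M + 3 - 4 * L\<^sup>2) * D1)
      - (M + L) * (16 * M\<^sup>2 - 1) * (2 * (M - L) * M * D1)
      = 2 * M * N * ((4 * M\<^sup>2 + 7 * M + L + 3) * D1) + 2 * M * (M - L) * (4 * L\<^sup>2 + 2 * L) * D1"
    unfolding N_def by algebra
  moreover have "2 * M * (M - L) * (4 * L\<^sup>2 + 2 * L) * D1 \<ge> 0"
    using bounds pos by simp
  ultimately have "2 * M * N * ((4 * M\<^sup>2 + 7 * M + L + 3) * D1)
      \<le> 2 * M * N * (2 * (M + 1 - L) * (M + 1) * D2)"
    using 1 by linarith
  moreover have "2 * M * N > 0" using bounds N by simp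
  ultimately show ?case
    unfolding M_def L_def D1_def D2_def by (simp only: mult_le_cancel_left_pos)
qed

section \<open>Positivity of the quadratic form\<close>

text \<open>Up to a positive factor, the difference of the two sides is the value of the quadratic
  polynomial at the lower bound for the ratio; in the next lemma it is its derivative there.
  In the variables \<open>l - 2\<close> and \<open>m - l\<close> both have nonnegative coefficients only.\<close>

lemma quadratic_form_at_bound_pos:
  fixes l m y :: real
  assumes "l \<ge> 2" "y \<ge> 0" "m = l + y"
  shows "(m\<^sup>2 + 1) * y * ((4 * m\<^sup>2 + 7 * m + l + 3) * (4 * m\<^sup>2 - m + l) + y * (4 * l\<^sup>2 + 2 * l))
    < m * (y + 1) * (m + 1) * (4 * m\<^sup>2 - m + l)\<^sup>2"
proof -
  define x where "x = l - 2"
  have x: "x \<ge> 0" and l: "l = x + 2" using assms(1) by (simp_all add: x_def)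
  have "m * (y + 1) * (m + 1) * (4 * m\<^sup>2 - m + l)\<^sup>2
      - (m\<^sup>2 + 1) * y * ((4 * m\<^sup>2 + 7 * m + l + 3) * (4 * m\<^sup>2 - m + l) + y * (4 * l\<^sup>2 + 2 * l))
    = 1536 + 2896 * y + 2129 * y ^ 2 + 782 * y ^ 3 + 145 * y ^ 4 + 12 * y ^ 5 + 4352 * x + 7280
      * x * y + 4695 * x * y ^ 2 + 1489 * x * y ^ 3 + 238 * x * y ^ 4 + 16 * x * y ^ 5 + 5120 *
      x ^ 2 + 7204 * x ^ 2 * y + 3716 * x ^ 2 * y ^ 2 + 852 * x ^ 2 * y ^ 3 + 76 * x ^ 2 * y ^ 4
      + 3200 * x ^ 3 + 3512 * x ^ 3 * y + 1262 * x ^ 3 * y ^ 2 + 152 * x ^ 3 * y ^ 3 + 1120 * x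
      ^ 4 + 844 * x ^ 4 * y + 156 * x ^ 4 * y ^ 2 + 208 * x ^ 5 + 80 * x ^ 5 * y + 16 * x ^ 6"
    unfolding assms(3) l by (simp add: algebra_simps power_numeral_reduce)
  \<comment> \<open>Strictness comes from the constant term 1536.\<close>
  also have "\<dots> > 0"
    using x assms(2) by (intro add_pos_nonneg mult_nonneg_nonneg zero_le_power) simp_all
  finally show ?thesis by simp
qed

lemma quadratic_form_slope_nonneg:
  fixes l m y :: real
  assumes "l \<ge> 2" "y \<ge> 0" "m = l + y"
  shows "(m\<^sup>2 + 1) * (8 * m\<^sup>2 + 8 * m + 3 - 4 * l\<^sup>2) * y
    \<le> 2 * m * (y + 1) * (m + 1) * (4 * m\<^sup>2 - m + l)"
proof -
  define x where "x = l - 2"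
  have x: "x \<ge> 0" and l: "l = x + 2" using assms(1) by (simp_all add: x_def)
  have "2 * m * (y + 1) * (m + 1) * (4 * m\<^sup>2 - m + l)
      - (m\<^sup>2 + 1) * (8 * m\<^sup>2 + 8 * m + 3 - 4 * l\<^sup>2) * y
    = 192 + 357 * y + 230 * y ^ 2 + 65 * y ^ 3 + 6 * y ^ 4 + 352 * x + 562 * x * y + 276 * x * y
      ^ 2 + 44 * x * y ^ 3 + 240 * x ^ 2 + 303 * x ^ 2 * y + 94 * x ^ 2 * y ^ 2 + 4 * x ^ 2 * y
      ^ 3 + 72 * x ^ 3 + 64 * x ^ 3 * y + 8 * x ^ 3 * y ^ 2 + 8 * x ^ 4 + 4 * x ^ 4 * y"
    unfolding assms(3) l by (simp add: algebra_simps power_numeral_reduce)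
  also have "\<dots> \<ge> 0"
    using x assms(2) by (intro add_nonneg_nonneg mult_nonneg_nonneg zero_le_power) simp_all
  finally show ?thesis by simp
qed

section \<open>The strengthened log-concavity inequality\<close>

theorem corollary3p3:
  fixes l m :: nat
  assumes "l \<ge> 2" and "m \<ge> l + 1"
  shows "(boros_moll l m)\<^sup>2 / (boros_moll l (m - 1) * boros_moll l (m + 1))
           > ((real m)\<^sup>2 + 1) / (real m)\<^sup>2"
proof -
  define M L y where "M = real m" and "L = real l" and "y = M - L"
  define D0 D1 D2 where "D0 = boros_moll l (m - 1)" and "D1 = boros_moll l m"
    and "D2 = boros_moll l (m + 1)"
  define N where "N = 4 * M\<^sup>2 - M + L"
  define a where "a = 8 * M\<^sup>2 + 8 * M + 3 - 4 * L\<^sup>2"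
  define b where "b = (M + L) * (16 * M\<^sup>2 - 1)"
  have L: "L \<ge> 2" and y: "y \<ge> 1" and My: "M = L + y"
    using assms by (simp_all add: M_def L_def y_def)
  have D: "D0 > 0" "D1 > 0" "D2 > 0"
    using assms by (auto simp: D0_def D1_def D2_def intro!: boros_moll_pos)
  have rec: "4 * (y + 1) * M * (M + 1) * D2 = 2 * M * a * D1 - b * D0"
    using boros_moll_recurrence[of m l] assms
    by (simp add: M_def L_def D0_def D1_def D2_def a_def b_def y_def algebra_simps)
  obtain j where j: "m = Suc j" "l \<le> j"
    using assms by (cases m) auto
  have bound: "N * D0 \<le> 2 * y * M * D1"
    using boros_moll_ratio_lower_bound[of l j] assms(1) j
    by (simp add: N_def M_def L_def D0_def D1_def y_def algebra_simps power2_eq_square)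
  \<comment> \<open>The slack in the lower bound for \<open>D1\<close>. Substituting
    \<open>2 * y * M * D1 = N * D0 + t\<close> expands the quadratic form around that bound.\<close>
  define t where "t = 2 * y * M * D1 - N * D0"
  have t: "t \<ge> 0" using bound by (simp add: t_def)
  \<comment> \<open>\<open>?Q\<close> is
    \<open>M\<^sup>2 * D1\<^sup>2 - (M\<^sup>2 + 1) * D0 * D2\<close> times
    \<open>4 * (y + 1) * M * (M + 1)\<close>, with \<open>D2\<close> eliminated by the recurrence.
    \<open>?A\<close> and \<open>?B\<close> are the coefficients of \<open>D0\<^sup>2\<close> and
    \<open>D0 * t\<close> in the expansion of \<open>y\<^sup>2 * ?Q\<close>.\<close>
  let ?Q = "4 * (y + 1) * M ^ 3 * (M + 1) * D1\<^sup>2 - (M\<^sup>2 + 1) * D0 * (2 * M * a * D1 - b * D0)"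
  let ?A = "M * (y + 1) * (M + 1) * N\<^sup>2
    - (M\<^sup>2 + 1) * y * ((4 * M\<^sup>2 + 7 * M + L + 3) * N + y * (4 * L\<^sup>2 + 2 * L))"
  let ?B = "2 * M * (y + 1) * (M + 1) * N - (M\<^sup>2 + 1) * a * y"
  \<comment> \<open>The same identity as in the induction step of the ratio bound; it brings the
    coefficient of \<open>D0\<^sup>2\<close> into the form of
    \<open>quadratic_form_at_bound_pos\<close>.\<close>
  have "a * N - b * y = (4 * M\<^sup>2 + 7 * M + L + 3) * N + y * (4 * L\<^sup>2 + 2 * L)"
    unfolding a_def b_def N_def y_def by algebra
  then have "y * ((4 * M\<^sup>2 + 7 * M + L + 3) * N + y * (4 * L\<^sup>2 + 2 * L)) = y * (a * N - b * y)"
    by simp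
  then have "y\<^sup>2 * ?Q = ?A * D0\<^sup>2 + ?B * D0 * t + M * (y + 1) * (M + 1) * t\<^sup>2"
    unfolding t_def by algebra
  also have "\<dots> > 0"
  proof (intro add_pos_nonneg mult_nonneg_nonneg)
    show "?A * D0\<^sup>2 > 0"
      using quadratic_form_at_bound_pos[OF L _ My] y D by (simp add: N_def)
    show "?B \<ge> 0"
      using quadratic_form_slope_nonneg[OF L _ My] y by (simp add: N_def a_def)
  qed (use D t y L My in simp_all)
  finally have "?Q > 0"
    using y by (simp add: zero_less_mult_iff)
  then have "4 * (y + 1) * M * (M + 1) * ((M\<^sup>2 + 1) * (D0 * D2))
      < 4 * (y + 1) * M * (M + 1) * (M\<^sup>2 * D1\<^sup>2)"
    unfolding rec[symmetric] by (simp add: power2_eq_square power3_eq_cube mult_ac)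
  then have "(M\<^sup>2 + 1) * (D0 * D2) < M\<^sup>2 * D1\<^sup>2"
    using y L My by (subst (asm) mult_less_cancel_left_pos) auto
  then have "(M\<^sup>2 + 1) / M\<^sup>2 < D1\<^sup>2 / (D0 * D2)"
    using D L y My by (simp add: divide_simps mult_ac)
  then show ?thesis
    by (simp add: M_def D0_def D1_def D2_def)
qed

end
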